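(* Let $\mathbf L=(L,\vee,\wedge,{}',0,1)$ be a lattice with complementation. For $x,y\in L$ put $x+_1y:=(x'\wedge y)\vee(x\wedge y')$ and $x+_2y:=(x\vee y)\wedge(x'\vee y')$. Then $\mathbf L$ is Boolean if and only if at least one of the binary operations $+_1$, $+_2$ on $L$ is associative.
   Context: A lattice with complementation is an algebra $(L,\vee,\wedge,{}',0,1)$ such that $(L,\vee,\wedge,0,1)$ is a bounded lattice and $'$ is a unary operation on $L$ with $x\vee x'=1$ and $x\wedge x'=0$ for all $x\in L$; the operation $'$ is not assumed to be antitone or an involution. It is called Boolean (a Boolean lattice) if its underlying lattice is distributive. *)

theory Defs
  imports "HOL-Library.Complemented_Lattices"
begin

text \<open>
  A lattice with complementation is a type of class \<^class>\<open>complemented_lattice\<close>, with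
  \<open>- x\<close> for \<open>x'\<close>. The class also has a binary \<open>x - y\<close>, which is determined by the other
  operations (\<open>x - y = inf x (- y)\<close>) and plays no role here.
\<close>

context
  includes lattice_syntax
begin

definition plus1 :: "'a::complemented_lattice \<Rightarrow> 'a \<Rightarrow> 'a"  (infixl \<open>+\<^sub>1\<close> 65)
  where "x +\<^sub>1 y = (- x \<sqinter> y) \<squnion> (x \<sqinter> - y)"

definition plus2 :: "'a::complemented_lattice \<Rightarrow> 'a \<Rightarrow> 'a"  (infixl \<open>+\<^sub>2\<close> 65)
  where "x +\<^sub>2 y = (x \<squnion> y) \<sqinter> (- x \<squnion> - y)"

end

text \<open>Boolean means only that the underlying lattice is distributive; it is a property of the
  given operations, so it is stated with the predicate of class \<^class>\<open>distrib_lattice\<close>. The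
  argument only serves to name the type.\<close>

definition is_boolean :: "'a::complemented_lattice itself \<Rightarrow> bool"
  where "is_boolean _ \<longleftrightarrow>
    class.distrib_lattice (inf :: 'a \<Rightarrow> 'a \<Rightarrow> 'a) (\<le>) (<) sup"

end

theory Submission
  imports Defs
begin

text \<open>
  In a Boolean lattice both operations are the usual symmetric difference, which is associative.

  Conversely, let \<open>+\<^sub>1\<close> be associative. It is always commutative, with \<open>x +\<^sub>1 x = 0\<close>,
  \<open>x +\<^sub>1 0 = x\<close> and \<open>x +\<^sub>1 1 = x'\<close>; so \<open>L\<close> is an abelian group of exponent 2 in which
  complementation is translation by \<open>1\<close>, and \<open>x'' = x\<close>. The order enters through \<open>x +\<^sub>1 y = x \<and> y'\<close>
  for \<open>y \<le> x\<close>: translating by \<open>y\<close> maps everything above \<open>y\<close> below itself. If \<open>w \<and> y' = 0\<close>, then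
  \<open>w +\<^sub>1 y = w' \<and> y\<close> lies below \<open>y\<close>, so adding \<open>y\<close> once more gives back \<open>w = y \<and> (w' \<and> y)'\<close>, whence
  \<open>w \<le> y\<close>. Thus \<open>y'\<close> is the pseudocomplement of \<open>y\<close>, and a lattice with an involutive
  pseudocomplementation is distributive (\<open>distrib_if_disjoint_compl_imp_le\<close>).

  The dual of \<open>+\<^sub>1\<close> is \<open>(x' \<or> y) \<and> (x \<or> y')\<close>. If \<open>+\<^sub>2\<close> is associative, \<open>L\<close> is again a group of
  exponent 2 in which complementation is translation by \<open>1\<close>, and this dual operation is
  \<open>x +\<^sub>2 y +\<^sub>2 1\<close>. It is therefore associative too, and the first case applies to the dual lattice.
\<close>

context complemented_lattice
begin

lemma compl_bot_is_top: "- bot = top"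
  by (metis sup_bot_left sup_compl_top)

lemma compl_top_is_bot: "- top = bot"
  by (metis inf_top_left inf_compl_bot)

text \<open>
  Under these hypotheses \<open>u \<and> v = 0\<close> is equivalent to \<open>u \<le> v'\<close>. Let \<open>b\<close> be the right-hand side, a
  lower bound of \<open>x \<and> (y \<or> z)\<close>, and put \<open>w = x \<and> (y \<or> z) \<and> b'\<close>. Since \<open>y \<and> w\<close> and \<open>z \<and> w\<close> lie
  below both \<open>b\<close> and \<open>b'\<close>, they are \<open>0\<close>, so \<open>y \<or> z \<le> w'\<close>. As also \<open>w \<le> y \<or> z\<close>, \<open>w\<close> vanishes.
\<close>

lemma distrib_if_disjoint_compl_imp_le:
  assumes invol: "\<And>x. - (- x) = x"
    and disjoint: "\<And>x y. inf x (- y) = bot \<Longrightarrow> x \<le> y"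
  shows "inf x (sup y z) = sup (inf x y) (inf x z)"
proof -
  let ?a = "inf x (sup y z)" and ?b = "sup (inf x y) (inf x z)"
  define w where "w = inf ?a (- ?b)"
  have below_compl: "u \<le> - w" if "inf x u \<le> ?b" for u
  proof (rule disjoint)
    have "inf u w \<le> inf x u"
      unfolding w_def by (simp add: le_infI2 le_infI1)
    also note that
    finally have "inf u w \<le> ?b" .
    moreover have "inf u w \<le> - ?b"
      unfolding w_def by (intro le_infI2) (rule order_refl)
    ultimately have "inf u w \<le> inf ?b (- ?b)"
      by (rule inf_greatest)
    then show "inf u (- (- w)) = bot"
      by (simp add: invol bot_unique)
  qed
  have "sup y z \<le> - w"
    by (intro sup_least below_compl) simp_all
  moreover have "w \<le> sup y z"
    unfolding w_def by (simp add: le_infI1)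
  ultimately have "w \<le> inf w (- w)"
    by (intro inf_greatest order_refl) (rule order_trans)
  then have "w = bot"
    by (simp add: bot_unique)
  then have "?a \<le> ?b"
    unfolding w_def by (rule disjoint)
  moreover have "?b \<le> ?a"
    by (simp add: le_infI2 le_supI1 le_supI2)
  ultimately show ?thesis
    by (rule order.antisym)
qed

text \<open>
  The operation is a variable with a defining equation, rather than a term, so that the lemma
  can be instantiated in the dual lattice.
\<close>

lemma distrib_if_sym_diff_assoc:
  fixes f :: "'a \<Rightarrow> 'a \<Rightarrow> 'a"
  assumes f: "\<And>x y. f x y = sup (inf (- x) y) (inf x (- y))"
    and assoc: "\<And>x y z. f (f x y) z = f x (f y z)"
  shows "inf x (sup y z) = sup (inf x y) (inf x z)"
proof -
  have self: "f x x = bot" and bot: "f x bot = x" and top: "f x top = - x" for x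
    by (simp_all add: f compl_bot_is_top compl_top_is_bot)
  have below: "f x y = inf x (- y)" if "y \<le> x" for x y
  proof -
    have "inf (- x) y \<le> inf (- x) x"
      using that by (rule inf_mono[OF order_refl])
    then have "inf (- x) y = bot"
      by (simp add: bot_unique)
    then show ?thesis
      by (simp add: f)
  qed
  have invol: "- (- x) = x" for x
    by (metis assoc top self bot)
  have "w \<le> y" if "inf w (- y) = bot" for w y
  proof -
    have wy: "f w y = inf (- w) y"
      using that by (simp add: f)
    have commute: "f (inf (- w) y) y = f y (inf (- w) y)"
      by (simp add: f inf_commute sup_commute)
    have "w = f (f w y) y"
      by (simp add: assoc self bot)
    also have "\<dots> = inf y (- inf (- w) y)"
      by (simp add: wy commute below)
    finally show ?thesis
      by (metis inf_le1)
  qed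
  with invol show ?thesis
    by (rule distrib_if_disjoint_compl_imp_le)
qed

lemma dual_distrib_if_dual_sym_diff_assoc:
  fixes f :: "'a \<Rightarrow> 'a \<Rightarrow> 'a"
  assumes "\<And>x y. f x y = inf (sup (- x) y) (sup x (- y))"
    and "\<And>x y z. f (f x y) z = f x (f y z)"
  shows "sup x (inf y z) = inf (sup x y) (sup x z)"
  by (rule complemented_lattice.distrib_if_sym_diff_assoc[OF dual_complemented_lattice, of f])
    (fact assms)+

end

lemma is_boolean_if_plus1_assoc:
  assumes "semigroup ((+\<^sub>1) :: 'a::complemented_lattice \<Rightarrow> 'a \<Rightarrow> 'a)"
  shows "is_boolean TYPE('a)"
proof -
  have "inf x (sup y z) = sup (inf x y) (inf x z)" for x y z :: 'a
    using plus1_def semigroup.assoc[OF assms] by (rule distrib_if_sym_diff_assoc)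
  then show ?thesis
    unfolding is_boolean_def by unfold_locales (rule distrib_imp1)
qed

lemma is_boolean_if_plus2_assoc:
  assumes "semigroup ((+\<^sub>2) :: 'a::complemented_lattice \<Rightarrow> 'a \<Rightarrow> 'a)"
  shows "is_boolean TYPE('a)"
proof -
  interpret plus2: semigroup "(+\<^sub>2) :: 'a \<Rightarrow> 'a \<Rightarrow> 'a"
    by (fact assms)
  interpret plus2: abel_semigroup "(+\<^sub>2) :: 'a \<Rightarrow> 'a \<Rightarrow> 'a"
    by unfold_locales (simp add: plus2_def sup_commute)
  have self: "x +\<^sub>2 x = bot" and bot: "x +\<^sub>2 bot = x" and top: "x +\<^sub>2 top = - x" for x :: 'a
    by (simp_all add: plus2_def compl_bot_is_top compl_top_is_bot)
  have invol: "- (- x) = x" for x :: 'a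
    by (metis plus2.assoc top self bot)
  have "x +\<^sub>2 y +\<^sub>2 top = inf (sup (- x) y) (sup x (- y))" for x y :: 'a
  proof -
    have "x +\<^sub>2 y +\<^sub>2 top = x +\<^sub>2 - y"
      by (simp only: plus2.assoc flip: top)
    then show ?thesis
      by (simp add: plus2_def invol inf_commute)
  qed
  moreover have "(x +\<^sub>2 y +\<^sub>2 top) +\<^sub>2 z +\<^sub>2 top = x +\<^sub>2 (y +\<^sub>2 z +\<^sub>2 top) +\<^sub>2 top" for x y z :: 'a
    by (simp only: plus2.assoc plus2.commute plus2.left_commute)
  ultimately have "sup x (inf y z) = inf (sup x y) (sup x z)" for x y z :: 'a
    by (rule dual_distrib_if_dual_sym_diff_assoc)
  then show ?thesis
    unfolding is_boolean_def by unfold_locales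
qed

lemma plus1_assoc_if_is_boolean:
  assumes "is_boolean TYPE('a::complemented_lattice)"
  shows "semigroup ((+\<^sub>1) :: 'a \<Rightarrow> 'a \<Rightarrow> 'a)"
proof -
  interpret distrib: distrib_lattice "inf :: 'a \<Rightarrow> 'a \<Rightarrow> 'a" "(\<le>)" "(<)" sup
    using assms by (simp add: is_boolean_def)
  interpret abstract_boolean_algebra_sym_diff "inf :: 'a \<Rightarrow> 'a \<Rightarrow> 'a" sup uminus bot top "(+\<^sub>1)"
    by unfold_locales
      (fact distrib.inf_sup_distrib1 distrib.sup_inf_distrib1 | simp add: plus1_def sup_commute)+
  show ?thesis
    by (rule xor.semigroup_axioms)
qed

theorem theorem3p3:
  shows "is_boolean TYPE('a::complemented_lattice) \<longleftrightarrow>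
    semigroup ((+\<^sub>1) :: 'a \<Rightarrow> 'a \<Rightarrow> 'a) \<or> semigroup ((+\<^sub>2) :: 'a \<Rightarrow> 'a \<Rightarrow> 'a)"
  using is_boolean_if_plus1_assoc is_boolean_if_plus2_assoc plus1_assoc_if_is_boolean by blast

end
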